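(* There exist universal constants $C_0, C' > 0$ such that the following holds. Let $X \subset \mathbb{R}^m$ be a finite nonempty set with doubling constant $\lambda_X$, let $\epsilon \in (0,1/2)$, let $d \ge 1$ be an integer with $d \ge C_0 \cdot \log\lambda_X \cdot \log(1/\epsilon)/\epsilon^2$, and let $G$ be a random projection from $\mathbb{R}^m$ to $\mathbb{R}^d$. Let $\mathcal{F}_d \subseteq X$ be a (random, depending measurably on $G$) set of facilities such that $G\mathcal{F}_d$ is a locally optimal solution for the dataset $GX$ for facility location with squared costs. Then the squared facility location cost of $\mathcal{F}_d$ evaluated for $X$ in $\mathbb{R}^m$, denoted $\mathrm{cost}_m(\mathcal{F}_d)$, satisfies $$ \mathbb{E}[\mathrm{cost}_m(\mathcal{F}_d)] \le \mathbb{E}|\mathcal{F}_d| + C' \cdot \sum_{p \in X} r_p ,$$ where $r_p$ is the squared-cost radius of $p$ in $X$ and expectations are over $G$.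
   Context: All norms are Euclidean. Facility location with squared costs: for a finite nonempty dataset $Y$ in a Euclidean space, a solution is a nonempty subset $\mathcal{F} \subseteq Y$, with cost $|\mathcal{F}| + \sum_{y \in Y} \min_{f \in \mathcal{F}} \|y - f\|^2$. Squared-cost radii: for a finite dataset $Y$ and $p \in Y$, the radius $r_p > 0$ of $p$ in $Y$ is the unique number with $\sum_{q \in Y,\ \|p-q\| \le r_p} (r_p^2 - \|p-q\|^2) = 1$ (the sum includes $q = p$). A solution $\mathcal{F} \subseteq Y$ is locally optimal for $Y$ (for squared costs) if for every $p \in Y$ there is $f \in \mathcal{F}$ with $\|p-f\| \le 3 r_p$. For the dataset $GX = \{Gx : x \in X\}$ the radii are computed in $\mathbb{R}^d$ from the points $Gx$. Doubling constant: for $x \in X$, $r > 0$ let $B(x,r) = \{y \in X : \|x-y\| \le r\}$. The doubling constant $\lambda_X$ is the smallest $\lambda$ such that for all $x \in X$, $r > 0$ there is $S \subseteq X$ with $|S| \le \lambda$ and $B(x,r) \subseteq \bigcup_{s \in S} B(s, r/2)$. A random projection from $\mathbb{R}^m$ to $\mathbb{R}^d$ is a random linear map $G$ given by a $d \times m$ matrix with i.i.d. entries drawn from $\mathcal{N}(0, 1/d)$ (variance $1/d$). Almost surely $G$ is injective on $X$. *)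

theory Defs
  imports "HOL-Probability.Probability"
begin

text \<open>
  The constants of the theorem must not depend on the dimensions, so the dimension is a natural
  number and not a type: a point of \<open>\<real>\<^sup>n\<close> is an element of \<open>topspace (Euclidean_space n)\<close>, i.e. a
  function \<open>nat \<Rightarrow> real\<close> that vanishes at all indices \<open>i \<ge> n\<close>.
\<close>

definition edist :: "nat \<Rightarrow> (nat \<Rightarrow> real) \<Rightarrow> (nat \<Rightarrow> real) \<Rightarrow> real" where
  "edist n x y = L2_set (\<lambda>i. x i - y i) {..<n}"

definition fl_cost :: "nat \<Rightarrow> (nat \<Rightarrow> real) set \<Rightarrow> (nat \<Rightarrow> real) set \<Rightarrow> real" where
  "fl_cost n Y F = real (card F) + (\<Sum>y\<in>Y. Min ((\<lambda>f. (edist n y f)\<^sup>2) ` F))"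

definition sq_radius :: "nat \<Rightarrow> (nat \<Rightarrow> real) set \<Rightarrow> (nat \<Rightarrow> real) \<Rightarrow> real" where
  "sq_radius n Y p =
     (THE r. r > 0 \<and> (\<Sum>q\<in>{q \<in> Y. edist n p q \<le> r}. r\<^sup>2 - (edist n p q)\<^sup>2) = 1)"

definition locally_optimal :: "nat \<Rightarrow> (nat \<Rightarrow> real) set \<Rightarrow> (nat \<Rightarrow> real) set \<Rightarrow> bool" where
  "locally_optimal n Y F \<longleftrightarrow>
     F \<noteq> {} \<and> F \<subseteq> Y \<and> (\<forall>p\<in>Y. \<exists>f\<in>F. edist n p f \<le> 3 * sq_radius n Y p)"

definition rel_ball :: "nat \<Rightarrow> (nat \<Rightarrow> real) set \<Rightarrow> (nat \<Rightarrow> real) \<Rightarrow> real \<Rightarrow> (nat \<Rightarrow> real) set" where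
  "rel_ball n X x r = {y \<in> X. edist n x y \<le> r}"

definition doubling_constant :: "nat \<Rightarrow> (nat \<Rightarrow> real) set \<Rightarrow> nat" where
  "doubling_constant n X =
     (LEAST l. \<forall>x\<in>X. \<forall>r>0. \<exists>S\<subseteq>X. finite S \<and> card S \<le> l \<and>
        rel_ball n X x r \<subseteq> (\<Union>s\<in>S. rel_ball n X s (r / 2)))"

text \<open>A \<open>d \<times> m\<close> matrix is its family of entries indexed by \<open>{..<d} \<times> {..<m}\<close>.\<close>

definition mat_apply :: "nat \<Rightarrow> nat \<Rightarrow> (nat \<times> nat \<Rightarrow> real) \<Rightarrow> (nat \<Rightarrow> real) \<Rightarrow> nat \<Rightarrow> real" where
  "mat_apply d m G x = (\<lambda>i. if i < d then \<Sum>j<m. G (i, j) * x j else 0)"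

text \<open>\<open>normal_density\<close> takes the standard deviation, here \<open>sqrt (1 / d)\<close>, and not the variance.\<close>

definition random_projection :: "nat \<Rightarrow> nat \<Rightarrow> (nat \<times> nat \<Rightarrow> real) measure" where
  "random_projection d m =
     PiM ({..<d} \<times> {..<m})
       (\<lambda>_. density lborel (\<lambda>t. ennreal (normal_density 0 (sqrt (1 / real d)) t)))"

lemma prob_space_random_projection:
  assumes "d \<ge> 1"
  shows "prob_space (random_projection d m)"
  unfolding random_projection_def
  by (intro prob_space_PiM prob_space_normal_density) (use assms in simp)

lemma sq_radius_sum_eq:
  assumes "finite Y" "r \<ge> 0"
  shows "(\<Sum>q\<in>{q \<in> Y. edist n p q \<le> r}. r\<^sup>2 - (edist n p q)\<^sup>2)
       = (\<Sum>q\<in>Y. max 0 (r\<^sup>2 - (edist n p q)\<^sup>2))"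
proof -
  have nn: "edist n p q \<ge> 0" for q by (simp add: edist_def)
  have "max 0 (r\<^sup>2 - (edist n p q)\<^sup>2) = (if edist n p q \<le> r then r\<^sup>2 - (edist n p q)\<^sup>2 else 0)" for q
    using power_mono[of "edist n p q" r 2] power_mono[of r "edist n p q" 2] nn[of q] assms(2)
    by auto
  thus ?thesis using assms(1) by (simp add: sum.inter_filter)
qed

lemma sq_radius_ex1:
  assumes "finite Y" "p \<in> Y"
  shows "\<exists>!r. r > 0 \<and> (\<Sum>q\<in>{q \<in> Y. edist n p q \<le> r}. r\<^sup>2 - (edist n p q)\<^sup>2) = 1"
proof -
  define h where "h = (\<lambda>r::real. \<Sum>q\<in>Y. max 0 (r\<^sup>2 - (edist n p q)\<^sup>2))"
  have eq: "(\<Sum>q\<in>{q \<in> Y. edist n p q \<le> r}. r\<^sup>2 - (edist n p q)\<^sup>2) = h r" if "r > 0" for r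
    using sq_radius_sum_eq[OF assms(1)] that by (simp add: h_def)
  have self: "edist n p p = 0" by (simp add: edist_def L2_set_def)
  have h0: "h 0 = 0" by (simp add: h_def)
  have h1: "h 1 \<ge> 1"
    using member_le_sum[of p Y "\<lambda>q. max 0 (1\<^sup>2 - (edist n p q)\<^sup>2)"] assms self
    by (simp add: h_def)
  have "continuous_on {0..1} h" unfolding h_def by (intro continuous_intros)
  then obtain r where r: "0 \<le> r" "r \<le> 1" "h r = 1"
    using IVT'[of h 0 1 1] h0 h1 by auto
  have mono: "h r < h s" if "0 \<le> r" "r < s" for r s
  proof -
    have sq: "r\<^sup>2 < s\<^sup>2" using that by (simp add: power_strict_mono)
    show ?thesis unfolding h_def
    proof (rule sum_strict_mono_ex1[OF assms(1)])
      show "\<forall>q\<in>Y. max 0 (r\<^sup>2 - (edist n p q)\<^sup>2) \<le> max 0 (s\<^sup>2 - (edist n p q)\<^sup>2)"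
        using sq by auto
      show "\<exists>q\<in>Y. max 0 (r\<^sup>2 - (edist n p q)\<^sup>2) < max 0 (s\<^sup>2 - (edist n p q)\<^sup>2)"
        using sq self assms(2) zero_le_power2[of r] by (intro bexI[of _ p]) auto
    qed
  qed
  have "r > 0" using r h0 by (cases "r = 0") auto
  show ?thesis
  proof (rule ex1I[of _ r])
    show "r > 0 \<and> (\<Sum>q\<in>{q \<in> Y. edist n p q \<le> r}. r\<^sup>2 - (edist n p q)\<^sup>2) = 1"
      using \<open>r > 0\<close> r eq by simp
  next
    fix s assume s: "s > 0 \<and> (\<Sum>q\<in>{q \<in> Y. edist n p q \<le> s}. s\<^sup>2 - (edist n p q)\<^sup>2) = 1"
    hence "h s = 1" using eq[of s] by metis
    thus "s = r" using mono[of r s] mono[of s r] r s by (cases s r rule: linorder_cases) auto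
  qed
qed

end

theory Submission
  imports Defs
begin

text \<open>
  It suffices to bound the expected squared distance from each \<open>p\<close> to the facilities by a multiple
  of \<open>r\<^sup>2\<close>, where \<open>r\<close> is the radius of \<open>p\<close>, since \<open>r \<le> 1\<close>. If \<open>G\<close> stretches distances from \<open>p\<close>
  inside \<open>B(p,r)\<close> by at most \<open>u\<close>, then the radius of \<open>Gp\<close> is at most \<open>sqrt (u\<^sup>2 + 1) * r\<close>. So a
  facility at distance about \<open>4\<^sup>j r\<close> from \<open>p\<close> can serve \<open>Gp\<close> only if \<open>B(p,r)\<close> is stretched to
  radius \<open>2\<^sup>j r\<close> or some point at distance about \<open>4\<^sup>j r\<close> lands within \<open>6 * 2\<^sup>j r\<close> of \<open>Gp\<close>. The
  second event is covered by about \<open>\<lambda>\<close> to the power \<open>2j\<close> balls of radius \<open>r\<close>: in each of them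
  either the centre is contracted by \<open>O(2\<^sup>-\<^sup>j)\<close> or the ball is stretched by \<open>2\<^sup>j\<close>. Since \<open>\<lambda>\<close> is at
  most a small exponential of \<open>d\<close>, Gaussian tails make these probabilities summable against \<open>16\<^sup>j\<close>.
\<close>

section \<open>Gaussian tails\<close>

text \<open>Tilting a centred normal density by \<open>exp (t * x\<^sup>2)\<close> yields
  \<open>1 / c\<close> times the centred normal density of deviation \<open>s / c\<close>, where
  \<open>c\<^sup>2 = 1 - 2 * t * s\<^sup>2\<close>. Negative \<open>t\<close> is included and serves
  the lower tail.\<close>

lemma nn_integral_exp_square_normal:
  assumes s: "s > 0" and t: "2 * t * s\<^sup>2 < 1"
  shows "(\<integral>\<^sup>+x. ennreal (normal_density 0 s x) * ennreal (exp (t * x\<^sup>2)) \<partial>lborel)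
       = ennreal (1 / sqrt (1 - 2 * t * s\<^sup>2))"
proof -
  define c where "c = sqrt (1 - 2 * t * s\<^sup>2)"
  have c: "c > 0" "c\<^sup>2 = 1 - 2 * t * s\<^sup>2" using t by (auto simp: c_def)
  define s' where "s' = s / c"
  have s': "s' > 0" using s c by (simp add: s'_def)
  have eq: "normal_density 0 s x * exp (t * x\<^sup>2) = 1 / c * normal_density 0 s' x" for x
  proof -
    have "- x\<^sup>2 / (2 * s'\<^sup>2) = - x\<^sup>2 * c\<^sup>2 / (2 * s\<^sup>2)"
      using c s by (simp add: s'_def field_simps power2_eq_square)
    also have "\<dots> = - x\<^sup>2 / (2 * s\<^sup>2) + t * x\<^sup>2"
      unfolding c(2) using s by (simp add: field_simps)
    finally have e: "exp (- x\<^sup>2 / (2 * s'\<^sup>2)) = exp (- x\<^sup>2 / (2 * s\<^sup>2)) * exp (t * x\<^sup>2)"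
      by (simp flip: exp_add)
    have "sqrt (2 * pi * s'\<^sup>2) = sqrt (2 * pi * s\<^sup>2) / c"
      using c(1) s by (simp add: s'_def real_sqrt_mult real_sqrt_divide power_divide)
    then show ?thesis using e c by (simp add: normal_density_def)
  qed
  interpret P: prob_space "density lborel (\<lambda>x. ennreal (normal_density 0 s' x))"
    by (rule prob_space_normal_density[OF s'])
  have one: "(\<integral>\<^sup>+x. ennreal (normal_density 0 s' x) \<partial>lborel) = 1"
    using P.emeasure_space_1 by (simp add: emeasure_density)
  have "(\<integral>\<^sup>+x. ennreal (normal_density 0 s x) * ennreal (exp (t * x\<^sup>2)) \<partial>lborel)
      = (\<integral>\<^sup>+x. ennreal (1 / c) * ennreal (normal_density 0 s' x) \<partial>lborel)"
    by (intro nn_integral_cong)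
       (use eq c in \<open>simp add: ennreal_mult[symmetric] normal_density_nonneg\<close>)
  also have "\<dots> = ennreal (1 / c)" using one by (simp add: nn_integral_cmult)
  finally show ?thesis by (simp add: c_def)
qed

section \<open>Euclidean distance of coordinate functions\<close>

lemma edist_nonneg [simp]: "0 \<le> edist n x y"
  by (simp add: edist_def)

lemma edist_self [simp]: "edist n x x = 0"
  by (simp add: edist_def L2_set_def)

lemma edist_commute: "edist n x y = edist n y x"
  by (simp add: edist_def L2_set_def power2_commute)

lemma edist_triangle: "edist n x z \<le> edist n x y + edist n y z"
  using L2_set_triangle_ineq[of "\<lambda>i. x i - y i" "\<lambda>i. y i - z i" "{..<n}"]
  by (simp add: edist_def)

lemma edist_eq_0_iff:
  assumes "x \<in> topspace (Euclidean_space n)" "y \<in> topspace (Euclidean_space n)"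
  shows "edist n x y = 0 \<longleftrightarrow> x = y"
proof
  assume "edist n x y = 0"
  then have "x i = y i" for i
    using assms by (cases "i < n") (auto simp: edist_def L2_set_eq_0_iff topspace_Euclidean_space)
  then show "x = y" by blast
qed simp

lemma edist_square: "(edist n x y)\<^sup>2 = (\<Sum>i<n. (x i - y i)\<^sup>2)"
  by (simp add: edist_def L2_set_def sum_nonneg)

section \<open>The law of a projected distance\<close>

locale random_proj =
  fixes d m :: nat
  assumes d_ge_1: "d \<ge> 1"
begin

abbreviation M where "M \<equiv> random_projection d m"

sublocale prob_space M
  by (rule prob_space_random_projection[OF d_ge_1])

definition row :: "(nat \<Rightarrow> real) \<Rightarrow> nat \<Rightarrow> (nat \<times> nat \<Rightarrow> real) \<Rightarrow> real" where
  "row v i G = (\<Sum>j<m. G (i, j) * v j)"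

definition pdist :: "(nat \<times> nat \<Rightarrow> real) \<Rightarrow> (nat \<Rightarrow> real) \<Rightarrow> (nat \<Rightarrow> real) \<Rightarrow> real" where
  "pdist G x y = edist d (mat_apply d m G x) (mat_apply d m G y)"

lemma pdist_nonneg [simp]: "0 \<le> pdist G x y"
  by (simp add: pdist_def)

lemma pdist_self [simp]: "pdist G x x = 0"
  by (simp add: pdist_def)

lemma pdist_commute: "pdist G x y = pdist G y x"
  unfolding pdist_def by (rule edist_commute)

lemma pdist_triangle: "pdist G x z \<le> pdist G x y + pdist G y z"
  unfolding pdist_def by (rule edist_triangle)

lemma pdist_square: "(pdist G x y)\<^sup>2 = (\<Sum>i<d. (row (\<lambda>j. x j - y j) i G)\<^sup>2)"
  by (simp add: pdist_def edist_square mat_apply_def row_def sum_subtractf right_diff_distrib)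

lemma measurable_entry [measurable (raw)]:
  assumes "k \<in> {..<d} \<times> {..<m}"
  shows "(\<lambda>G. G k) \<in> borel_measurable M"
proof -
  have "(\<lambda>G. G k) \<in> measurable M (density lborel (\<lambda>t. ennreal (normal_density 0 (sqrt (1 / real d)) t)))"
    unfolding random_projection_def by (rule measurable_component_singleton[OF assms])
  then show ?thesis by simp
qed

lemma measurable_row: "i < d \<Longrightarrow> row v i \<in> borel_measurable M"
  unfolding row_def by (intro borel_measurable_sum borel_measurable_times measurable_entry) auto

lemma measurable_pdist [measurable]: "(\<lambda>G. pdist G x y) \<in> borel_measurable M"
proof -
  have "(\<lambda>G. sqrt (\<Sum>i<d. (row (\<lambda>j. x j - y j) i G)\<^sup>2)) \<in> borel_measurable M"
    by (intro borel_measurable_sqrt[THEN measurable_compose[rotated]] borel_measurable_sum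
        borel_measurable_power measurable_row) auto
  also have "(\<lambda>G. sqrt (\<Sum>i<d. (row (\<lambda>j. x j - y j) i G)\<^sup>2)) = (\<lambda>G. pdist G x y)"
    by (simp flip: pdist_square)
  finally show ?thesis .
qed

text \<open>The coordinates of a product measure are independent because their joint law is the
  product of the marginals. This criterion is applied to a nonempty index set, whence
  \<open>m > 0\<close>.\<close>

lemma indep_entries:
  assumes "m > 0"
  shows "indep_vars (\<lambda>_. borel) (\<lambda>k G. G k) ({..<d} \<times> {..<m})"
proof -
  define N where "N = density lborel (\<lambda>t. ennreal (normal_density 0 (sqrt (1 / real d)) t))"
  let ?I = "{..<d} \<times> {..<m}"
  have M: "M = PiM ?I (\<lambda>_. N)" by (simp add: random_projection_def N_def)
  have N: "prob_space N" unfolding N_def by (rule prob_space_normal_density) (use d_ge_1 in simp)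
  have "indep_vars (\<lambda>_. N) (\<lambda>k G. G k) ?I"
  proof (subst indep_vars_iff_distr_eq_PiM')
    show "?I \<noteq> {}" using assms d_ge_1 by (auto simp: lessThan_empty_iff)
    show "(\<lambda>G. G i) \<in> measurable M N" if "i \<in> ?I" for i
      unfolding M by (rule measurable_component_singleton[OF that])
    have "distr M (PiM ?I (\<lambda>_. N)) (\<lambda>x. \<lambda>i\<in>?I. x i) = distr M M (\<lambda>x. x)"
      by (rule distr_cong) (auto simp: M space_PiM PiE_def extensional_restrict)
    also have "\<dots> = M" by simp
    also have "M = PiM ?I (\<lambda>i. distr M N (\<lambda>G. G i))"
      unfolding M by (intro PiM_cong refl distr_PiM_component[symmetric] N)
    finally show "distr M (PiM ?I (\<lambda>_. N)) (\<lambda>x. \<lambda>i\<in>?I. x i)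
      = PiM ?I (\<lambda>i. distr M N (\<lambda>G. G i))" .
  qed
  from indep_vars_compose2[OF this, of "\<lambda>_ x. x" "\<lambda>_. borel"]
  show ?thesis by (simp add: N_def)
qed

lemma distributed_entry:
  assumes "k \<in> {..<d} \<times> {..<m}"
  shows "distributed M lborel (\<lambda>G. G k) (normal_density 0 (sqrt (1 / real d)))"
proof -
  define N where "N = density lborel (\<lambda>t. ennreal (normal_density 0 (sqrt (1 / real d)) t))"
  have N: "prob_space N" unfolding N_def by (rule prob_space_normal_density) (use d_ge_1 in simp)
  have "distr M lborel (\<lambda>G. G k) = distr M N (\<lambda>G. G k)"
    by (rule distr_cong) (auto simp: N_def)
  also have "\<dots> = N"
    unfolding random_projection_def N_def[symmetric] by (rule distr_PiM_component[OF N assms])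
  finally show ?thesis
    using measurable_entry[OF assms] by (simp add: distributed_def N_def)
qed

lemma distributed_row:
  assumes "i < d" and rho: "(\<Sum>j<m. (v j)\<^sup>2) = \<rho>\<^sup>2" "\<rho> > 0"
  shows "distributed M lborel (row v i) (normal_density 0 (\<rho> / sqrt d))"
proof -
  \<comment> \<open>Zero coefficients are dropped: a multiple of a normal variable has a normal
    density only if the factor is nonzero.\<close>
  define J where "J = {j. j < m \<and> v j \<noteq> 0}"
  have [simp]: "finite J" by (simp add: J_def)
  have JJ: "J \<subseteq> {..<m}" by (auto simp: J_def)
  have sumJ: "(\<Sum>j\<in>J. (v j)\<^sup>2) = \<rho>\<^sup>2"
    using sum.mono_neutral_left[of "{..<m}" J "\<lambda>j. (v j)\<^sup>2"] rho JJ by (auto simp: J_def)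
  have "J \<noteq> {}" using sumJ rho by auto
  then have "m > 0" by (auto simp: J_def)
  have row: "row v i = (\<lambda>G. \<Sum>j\<in>J. v j * G (i, j))"
    unfolding row_def fun_eq_iff
    by (intro allI sum.mono_neutral_cong_right) (auto simp: J_def)
  have ind: "indep_vars (\<lambda>_. borel) (\<lambda>j G. v j * G (i, j)) J"
  proof -
    have "indep_vars (\<lambda>j. PiM {(i, j)} (\<lambda>_. borel)) (\<lambda>j G. restrict (\<lambda>k. G k) {(i, j)}) J"
      by (rule indep_vars_restrict[OF indep_entries[OF \<open>m > 0\<close>]])
         (use assms JJ in \<open>auto simp: disjoint_family_on_def\<close>)
    from indep_vars_compose2[OF this, of "\<lambda>j x. v j * x (i, j)" "\<lambda>_. borel"]
    show ?thesis by (simp add: measurable_component_singleton)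
  qed
  have "distributed M lborel (\<lambda>G. v j * G (i, j)) (normal_density 0 (\<bar>v j\<bar> * sqrt (1 / real d)))"
    if "j \<in> J" for j
    using normal_density_affine[OF distributed_entry[of "(i, j)"], of "v j" 0] that assms d_ge_1
    by (auto simp: J_def)
  from sum_indep_normal[OF \<open>finite J\<close> \<open>J \<noteq> {}\<close> ind _ this]
  have "distributed M lborel (row v i)
      (normal_density 0 (sqrt (\<Sum>j\<in>J. (\<bar>v j\<bar> * sqrt (1 / real d))\<^sup>2)))"
    using d_ge_1 unfolding row by (auto simp: J_def)
  also have "(\<Sum>j\<in>J. (\<bar>v j\<bar> * sqrt (1 / real d))\<^sup>2) = \<rho>\<^sup>2 / d"
    using d_ge_1 by (simp add: power_mult_distrib power_divide real_sqrt_divide sumJ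
        flip: sum_divide_distrib)
  also have "sqrt (\<rho>\<^sup>2 / d) = \<rho> / sqrt d" using rho by (simp add: real_sqrt_divide)
  finally show ?thesis .
qed

text \<open>Divided by \<open>\<rho>\<^sup>2 / d\<close>, the squared projected distance is
  chi-square with \<open>d\<close> degrees of freedom, so its moment generating function is a
  \<open>d\<close>-fold product over the independent rows.\<close>

lemma mgf_pdist_square:
  assumes rho: "edist m x y = \<rho>" "\<rho> > 0" and t: "2 * t < 1"
  shows "(\<integral>\<^sup>+G. ennreal (exp (t * (real d / \<rho>\<^sup>2) * (pdist G x y)\<^sup>2)) \<partial>M)
       = ennreal ((1 / sqrt (1 - 2 * t)) ^ d)"
proof -
  define v where "v = (\<lambda>j. x j - y j)"
  have v: "(\<Sum>j<m. (v j)\<^sup>2) = \<rho>\<^sup>2" using edist_square[of m x y] rho by (simp add: v_def)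
  have "m > 0" using v rho by (cases m) auto
  define T where "T = t * (real d / \<rho>\<^sup>2)"
  have ind: "indep_vars (\<lambda>_. borel) (\<lambda>i G. exp (T * (row v i G)\<^sup>2)) {..<d}"
  proof -
    \<comment> \<open>Distinct rows use disjoint blocks of independent entries.\<close>
    have "indep_vars (\<lambda>i. PiM ({i} \<times> {..<m}) (\<lambda>_. borel)) (\<lambda>i G. restrict (\<lambda>k. G k) ({i} \<times> {..<m})) {..<d}"
      by (rule indep_vars_restrict[OF indep_entries[OF \<open>m > 0\<close>]])
         (auto simp: disjoint_family_on_def)
    from indep_vars_compose2[OF this, of "\<lambda>i w. exp (T * (\<Sum>j<m. w (i, j) * v j)\<^sup>2)" "\<lambda>_. borel"]
    have "indep_vars (\<lambda>_. borel)
       (\<lambda>i G. exp (T * (\<Sum>j<m. (restrict (\<lambda>k. G k) ({i} \<times> {..<m})) (i, j) * v j)\<^sup>2)) {..<d}"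
      by measurable
    also have "(\<lambda>i G. exp (T * (\<Sum>j<m. (restrict (\<lambda>k. G k) ({i} \<times> {..<m})) (i, j) * v j)\<^sup>2))
        = (\<lambda>i G. exp (T * (row v i G)\<^sup>2))"
      by (auto simp: row_def fun_eq_iff intro!: sum.cong)
    finally show ?thesis .
  qed
  have "(\<integral>\<^sup>+G. ennreal (exp (T * (pdist G x y)\<^sup>2)) \<partial>M)
      = (\<integral>\<^sup>+G. (\<Prod>i<d. ennreal (exp (T * (row v i G)\<^sup>2))) \<partial>M)"
    by (simp add: pdist_square v_def[symmetric] sum_distrib_left exp_sum prod_ennreal)
  also have "\<dots> = (\<integral>\<^sup>+G. ennreal (\<Prod>i<d. exp (T * (row v i G)\<^sup>2)) \<partial>M)"
    by (simp add: prod_ennreal)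
  also have "\<dots> = (\<Prod>i<d. \<integral>\<^sup>+G. ennreal (exp (T * (row v i G)\<^sup>2)) \<partial>M)"
    using indep_vars_nn_integral[of "{..<d}" "\<lambda>i G. ennreal (exp (T * (row v i G)\<^sup>2))"]
      indep_vars_compose2[OF ind, of "\<lambda>_ x. ennreal x" "\<lambda>_. borel"]
    by (simp add: prod_ennreal)
  also have "\<dots> = (\<Prod>i<d. ennreal (1 / sqrt (1 - 2 * t)))"
  proof (rule prod.cong[OF refl])
    fix i assume i: "i \<in> {..<d}"
    have s: "\<rho> / sqrt d > 0" using rho d_ge_1 by simp
    have Ts: "2 * T * (\<rho> / sqrt d)\<^sup>2 = 2 * t"
      using rho d_ge_1 by (simp add: T_def power_divide field_simps)
    have "(\<integral>\<^sup>+G. ennreal (exp (T * (row v i G)\<^sup>2)) \<partial>M)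
      = (\<integral>\<^sup>+x. ennreal (normal_density 0 (\<rho> / sqrt d) x) * ennreal (exp (T * x\<^sup>2)) \<partial>lborel)"
      by (rule distributed_nn_integral[OF distributed_row[OF _ v rho(2)], symmetric]) (use i in auto)
    also have "\<dots> = ennreal (1 / sqrt (1 - 2 * t))"
      using nn_integral_exp_square_normal[OF s, of T] Ts t by simp
    finally show "(\<integral>\<^sup>+G. ennreal (exp (T * (row v i G)\<^sup>2)) \<partial>M) = ennreal (1 / sqrt (1 - 2 * t))" .
  qed
  also have "\<dots> = ennreal ((1 / sqrt (1 - 2 * t)) ^ d)"
    by (simp add: ennreal_power t less_imp_le)
  finally show ?thesis by (simp add: T_def)
qed

text \<open>Chernoff bound with \<open>t = 1 / 4\<close> in \<open>mgf_pdist_square\<close>; the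
  value \<open>sqrt 2 ^ d\<close> is relaxed to \<open>exp (d / 2)\<close>. Only an upper bound
  \<open>\<rho>\<close> on the distance is asked for, so that one scale serves all points of a
  net.\<close>

lemma prob_pdist_gt:
  fixes u \<rho> :: real
  assumes "edist m x y \<le> \<rho>" "\<rho> > 0" "u \<ge> 0"
  shows "prob {G \<in> space M. u * \<rho> < pdist G x y} \<le> exp (d / 2 - d * u\<^sup>2 / 4)"
proof (cases "edist m x y = 0")
  case True
  \<comment> \<open>The points agree only in the first \<open>m\<close> coordinates, but these are
    all that the projection reads.\<close>
  then have "(\<Sum>i<m. (x i - y i)\<^sup>2) = 0" using edist_square[of m x y] by simp
  then have "\<forall>i<m. x i - y i = 0" by (subst (asm) sum_nonneg_eq_0_iff) auto
  then have "(pdist G x y)\<^sup>2 = 0" for G by (simp add: pdist_square row_def)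
  then have none: "{G \<in> space M. u * \<rho> < pdist G x y} = {}" using assms by (auto simp: not_less)
  show ?thesis unfolding none by simp
next
  case False
  define \<sigma> where "\<sigma> = edist m x y"
  have \<sigma>: "\<sigma> > 0" "\<sigma> \<le> \<rho>" using False assms by (auto simp: \<sigma>_def order_less_le)
  define s where "s = 1 / 4 * (real d / \<sigma>\<^sup>2)"
  have "s > 0" using \<sigma> d_ge_1 by (simp add: s_def)
  have "{G \<in> space M. u * \<rho> < pdist G x y} \<subseteq> {G \<in> space M. (pdist G x y)\<^sup>2 \<ge> u\<^sup>2 * \<sigma>\<^sup>2}"
  proof safe
    fix G assume "u * \<rho> < pdist G x y"
    moreover have "u * \<sigma> \<le> u * \<rho>" using \<sigma> assms by (intro mult_left_mono) auto
    ultimately have "u * \<sigma> \<le> pdist G x y" by linarith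
    then show "u\<^sup>2 * \<sigma>\<^sup>2 \<le> (pdist G x y)\<^sup>2"
      using \<sigma> assms power_mono[of "u * \<sigma>" "pdist G x y" 2] by (simp add: power_mult_distrib)
  qed
  then have "emeasure M {G \<in> space M. u * \<rho> < pdist G x y}
     \<le> emeasure M {G \<in> space M. (pdist G x y)\<^sup>2 \<ge> u\<^sup>2 * \<sigma>\<^sup>2}"
    by (intro emeasure_mono) auto
  also have "\<dots> \<le> ennreal (exp (- s * (u\<^sup>2 * \<sigma>\<^sup>2)))
       * (\<integral>\<^sup>+G. ennreal (exp (s * (pdist G x y)\<^sup>2)) * indicator (space M) G \<partial>M)"
    by (rule Chernoff_ineq_nn_integral_ge) (use \<open>s > 0\<close> in auto)
  also have "(\<integral>\<^sup>+G. ennreal (exp (s * (pdist G x y)\<^sup>2)) * indicator (space M) G \<partial>M)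
      = (\<integral>\<^sup>+G. ennreal (exp (s * (pdist G x y)\<^sup>2)) \<partial>M)"
    by (intro nn_integral_cong) auto
  also have "\<dots> = ennreal ((1 / sqrt (1 - 2 * (1 / 4))) ^ d)"
    unfolding s_def by (rule mgf_pdist_square) (use \<sigma> \<sigma>_def in auto)
  also have "\<dots> = ennreal (sqrt 2 ^ d)" by (simp add: real_sqrt_divide)
  also have "ennreal (exp (- s * (u\<^sup>2 * \<sigma>\<^sup>2))) * ennreal (sqrt 2 ^ d)
     = ennreal (exp (- d * u\<^sup>2 / 4) * sqrt 2 ^ d)"
    using \<sigma> by (simp add: s_def ennreal_mult[symmetric] field_simps)
  also have "\<dots> \<le> ennreal (exp (- d * u\<^sup>2 / 4) * exp (1 / 2) ^ d)"
  proof -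
    have "2 \<le> exp (1::real)" using exp_ge_add_one_self[of 1] by simp
    also have "\<dots> = (exp (1 / 2))\<^sup>2" by (simp flip: exp_of_nat_mult)
    finally have "sqrt 2 \<le> exp (1 / 2)" by (rule real_le_lsqrt[rotated -1]) auto
    then show ?thesis by (intro ennreal_leI mult_left_mono power_mono) auto
  qed
  also have "exp (- d * u\<^sup>2 / 4) * exp (1 / 2) ^ d = exp (d / 2 - d * u\<^sup>2 / 4)"
    by (simp flip: exp_of_nat_mult exp_add)
  finally show ?thesis by (simp add: emeasure_eq_measure)
qed

text \<open>Chernoff bound for the lower tail at parameter \<open>- t\<close> with
  \<open>t = 1 / (2 * \<delta>\<^sup>2)\<close>. This choice turns the exponential factor into
  \<open>exp (d / 2)\<close>, at most \<open>2 ^ d\<close>, and bounds the moment generating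
  function by \<open>\<delta> ^ d\<close>.\<close>

lemma prob_pdist_le:
  fixes \<delta> \<rho> :: real
  assumes "edist m x y \<ge> \<rho>" "\<rho> > 0" "\<delta> > 0"
  shows "prob {G \<in> space M. pdist G x y \<le> \<delta> * \<rho>} \<le> (2 * \<delta>) ^ d"
proof -
  define \<sigma> where "\<sigma> = edist m x y"
  have \<sigma>: "\<sigma> > 0" "\<rho> \<le> \<sigma>" using assms by (auto simp: \<sigma>_def)
  define t where "t = 1 / (2 * \<delta>\<^sup>2)"
  define s where "s = t * (real d / \<sigma>\<^sup>2)"
  have "t > 0" "s > 0" using \<sigma> assms d_ge_1 by (auto simp: s_def t_def)
  have "{G \<in> space M. pdist G x y \<le> \<delta> * \<rho>} \<subseteq> {G \<in> space M. (pdist G x y)\<^sup>2 \<le> \<delta>\<^sup>2 * \<sigma>\<^sup>2}"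
  proof safe
    fix G assume "pdist G x y \<le> \<delta> * \<rho>"
    moreover have "\<delta> * \<rho> \<le> \<delta> * \<sigma>" using \<sigma> assms by (intro mult_left_mono) auto
    ultimately have "pdist G x y \<le> \<delta> * \<sigma>" by linarith
    then show "(pdist G x y)\<^sup>2 \<le> \<delta>\<^sup>2 * \<sigma>\<^sup>2"
      using power_mono[of "pdist G x y" "\<delta> * \<sigma>" 2] by (simp add: power_mult_distrib)
  qed
  then have "emeasure M {G \<in> space M. pdist G x y \<le> \<delta> * \<rho>}
     \<le> emeasure M {G \<in> space M. (pdist G x y)\<^sup>2 \<le> \<delta>\<^sup>2 * \<sigma>\<^sup>2}"
    by (intro emeasure_mono) auto
  also have "\<dots> \<le> ennreal (exp (s * (\<delta>\<^sup>2 * \<sigma>\<^sup>2)))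
       * (\<integral>\<^sup>+G. ennreal (exp (- s * (pdist G x y)\<^sup>2)) * indicator (space M) G \<partial>M)"
    by (rule Chernoff_ineq_nn_integral_le) (use \<open>s > 0\<close> in auto)
  also have "(\<integral>\<^sup>+G. ennreal (exp (- s * (pdist G x y)\<^sup>2)) * indicator (space M) G \<partial>M)
      = (\<integral>\<^sup>+G. ennreal (exp (- t * (real d / \<sigma>\<^sup>2) * (pdist G x y)\<^sup>2)) \<partial>M)"
    by (intro nn_integral_cong) (auto simp: s_def)
  also have "\<dots> = ennreal ((1 / sqrt (1 - 2 * (- t))) ^ d)"
    by (rule mgf_pdist_square) (use \<sigma> \<sigma>_def \<open>t > 0\<close> in auto)
  also have "\<dots> \<le> ennreal (\<delta> ^ d)"
  proof -
    have "1 / \<delta> = sqrt (1 / \<delta>\<^sup>2)" using assms by (simp add: real_sqrt_divide)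
    also have "\<dots> \<le> sqrt (1 - 2 * (- t))" by (simp add: t_def)
    finally have "1 / sqrt (1 - 2 * (- t)) \<le> \<delta>"
      using assms \<open>t > 0\<close> by (simp add: divide_simps mult.commute)
    then show ?thesis using \<open>t > 0\<close> by (intro ennreal_leI power_mono) auto
  qed
  also have "ennreal (exp (s * (\<delta>\<^sup>2 * \<sigma>\<^sup>2))) * ennreal (\<delta> ^ d) = ennreal (exp (d / 2) * \<delta> ^ d)"
    using \<sigma> assms by (simp add: s_def t_def ennreal_mult[symmetric])
  also have "\<dots> \<le> ennreal (2 ^ d * \<delta> ^ d)"
  proof -
    have "exp (d / 2) = exp (1 / 2) ^ d" by (simp flip: exp_of_nat_mult)
    also have "\<dots> \<le> 2 ^ d" using exp_bound_half[of "1/2::real"] by (intro power_mono) auto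
    finally show ?thesis using assms by (intro ennreal_leI mult_right_mono) auto
  qed
  finally show ?thesis using assms
    by (simp add: emeasure_eq_measure power_mult_distrib mult_left_mono)
qed

end

section \<open>Chaining over balls\<close>

lemma doubling_constant_cover:
  assumes "finite X" "x \<in> X" "r > 0"
  obtains S where "S \<subseteq> X" "finite S" "card S \<le> doubling_constant n X"
    "rel_ball n X x r \<subseteq> (\<Union>s\<in>S. rel_ball n X s (r / 2))"
proof -
  let ?P = "\<lambda>l. \<forall>x\<in>X. \<forall>r>0. \<exists>S\<subseteq>X. finite S \<and> card S \<le> l \<and>
        rel_ball n X x r \<subseteq> (\<Union>s\<in>S. rel_ball n X s (r / 2))"
  have "?P (card X)"
    using assms(1) by (intro ballI allI impI exI[of _ X]) (force simp: rel_ball_def)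
  \<comment> \<open>Each point covers itself, so \<open>S = X\<close> is always a cover; hence the
    \<open>LEAST\<close> is attained.\<close>
  then have "?P (doubling_constant n X)" unfolding doubling_constant_def by (rule LeastI)
  then show ?thesis using assms that by blast
qed

text \<open>Let \<open>z\<close> be a nearest neighbour of \<open>x\<close>, at distance
  \<open>R\<close>. In a cover of the ball of radius \<open>R\<close> around \<open>x\<close> by
  balls of half the radius, the centre serving \<open>x\<close> is \<open>x\<close> itself, and that
  ball misses \<open>z\<close>, so a second centre is present.\<close>

lemma doubling_constant_ge_2:
  assumes "finite X" "X \<subseteq> topspace (Euclidean_space n)" "x \<in> X" "y \<in> X" "x \<noteq> y"
  shows "doubling_constant n X \<ge> 2"
proof -
  obtain z where z: "z \<in> X - {x}" "\<And>w. w \<in> X - {x} \<Longrightarrow> edist n x z \<le> edist n x w"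
  proof -
    let ?D = "edist n x ` (X - {x})"
    have "finite ?D" "?D \<noteq> {}" using assms by auto
    then obtain z where "z \<in> X - {x}" "Min ?D = edist n x z" using Min_in[of ?D] by blast
    then show ?thesis using that[of z] Min_le[OF \<open>finite ?D\<close>] by simp
  qed
  define R where "R = edist n x z"
  have "R > 0"
    using edist_eq_0_iff[of x n z] z assms edist_nonneg[of n x z] by (auto simp: R_def order_less_le)
  obtain S where S: "S \<subseteq> X" "finite S" "card S \<le> doubling_constant n X"
    "rel_ball n X x R \<subseteq> (\<Union>s\<in>S. rel_ball n X s (R / 2))"
    by (rule doubling_constant_cover[OF assms(1,3) \<open>R > 0\<close>])
  have "x \<in> rel_ball n X x R" "z \<in> rel_ball n X x R"
    using assms z \<open>R > 0\<close> by (auto simp: rel_ball_def R_def)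
  then obtain s t where "s \<in> S" "t \<in> S" "x \<in> rel_ball n X s (R / 2)" "z \<in> rel_ball n X t (R / 2)"
    using S(4) by blast
  then have st: "s \<in> S" "t \<in> S" "edist n s x \<le> R / 2" "edist n t z \<le> R / 2"
    by (auto simp: rel_ball_def)
  have "s = x"
    using z(2)[of s] st S(1) \<open>R > 0\<close> edist_commute[of n s x] by (fastforce simp: R_def)
  have "t \<noteq> x" using st \<open>R > 0\<close> by (auto simp: R_def)
  then have "card {s, t} = 2" using \<open>s = x\<close> by simp
  moreover have "card {s, t} \<le> card S" using st S by (intro card_mono) auto
  ultimately show ?thesis using S(3) by simp
qed

text \<open>The form in which the dimension hypothesis is used: \<open>\<epsilon>\<close> is gone,
  and a union bound over \<open>l\<close> balls costs a factor of at most
  \<open>exp (d / 200)\<close>. By \<open>l_ge_2\<close> a constant factor 2 can be absorbed into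
  another factor \<open>l\<close>.\<close>

locale doubling_proj = random_proj d m for d m +
  fixes X :: "(nat \<Rightarrow> real) set" and l :: nat
  assumes finite_X: "finite X" and X_sub: "X \<subseteq> topspace (Euclidean_space m)"
    and cover: "\<And>x r. x \<in> X \<Longrightarrow> r > 0 \<Longrightarrow> \<exists>S\<subseteq>X. finite S \<and> card S \<le> l \<and>
        rel_ball m X x r \<subseteq> (\<Union>s\<in>S. rel_ball m X s (r / 2))"
    and l_ge_2: "l \<ge> 2" and l_le: "real l \<le> exp (real d / 200)" and d_ge_100: "d \<ge> 100"
begin

lemma finite_rel_ball [simp]: "finite (rel_ball m X x r)"
  using finite_X by (simp add: rel_ball_def)

lemma event_rel_ball [measurable (raw)]:
  assumes "\<And>q. q \<in> X \<Longrightarrow> {G \<in> space M. P q G} \<in> events"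
  shows "{G \<in> space M. \<exists>q\<in>rel_ball m X x r. P q G} \<in> events"
  by (intro sets.sets_Collect_finite_Ex assms) (auto simp: rel_ball_def finite_X)

lemma union_bound:
  fixes b :: real
  assumes "finite S" "card S \<le> l" "b \<ge> 0" "\<And>s. s \<in> S \<Longrightarrow> A s \<in> events"
    "\<And>s. s \<in> S \<Longrightarrow> prob (A s) \<le> b"
  shows "prob (\<Union>s\<in>S. A s) \<le> l * b"
proof -
  have "prob (\<Union>s\<in>S. A s) \<le> (\<Sum>s\<in>S. prob (A s))"
    using assms by (intro finite_measure_subadditive_finite) auto
  also have "\<dots> \<le> card S * b" using assms sum_bounded_above[of S "\<lambda>s. prob (A s)" b] by simp
  also have "\<dots> \<le> l * b" using assms by (intro mult_right_mono) auto
  finally show ?thesis .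
qed

lemma two_l_le: "2 * real l \<le> exp (real d / 100)"
proof -
  have "2 * real l \<le> real l * real l" using l_ge_2 by (intro mult_right_mono) auto
  also have "\<dots> \<le> exp (real d / 200) * exp (real d / 200)" using l_le by (intro mult_mono) auto
  also have "\<dots> = exp (real d / 100)" by (simp flip: exp_add)
  finally show ?thesis .
qed

text \<open>The arithmetic that closes the induction over scales: the net point and the smaller ball
  each take half of the target bound, after the union bound over \<open>l\<close> centres.\<close>

lemma chaining_step:
  fixes u :: real
  assumes u: "u \<ge> 17"
  shows "l * (exp (d / 2 - real d * (u / 6)\<^sup>2 / 4) + exp (- real d * (3 * u / 2)\<^sup>2 / 288))
    \<le> exp (- real d * u\<^sup>2 / 288)"
proof -
  \<comment> \<open>In terms of \<open>w\<close> the two exponents are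
    \<open>d / 2 - 2 * d * w\<close> and \<open>- 9 / 4 * d * w\<close>. As 17 squared is 289,
    \<open>w \<ge> 1\<close>, and both lie below \<open>- d * w\<close> by at least
    \<open>d / 100\<close>, which pays for \<open>2 * l\<close>.\<close>
  define w where "w = u\<^sup>2 / 288"
  have w: "w \<ge> 1" using power_mono[OF u, of 2] by (simp add: w_def)
  have dw: "real d \<le> d * w" using mult_left_mono[OF w, of "real d"] by simp
  have bound: "l * exp (d * a) \<le> exp (- real d * w) / 2" if "d * a \<le> - real d * w - d / 100" for a :: real
  proof -
    have "2 * l * exp (d * a) \<le> exp (real d / 100) * exp (- real d * w - d / 100)"
      using two_l_le that by (intro mult_mono) auto
    also have "\<dots> = exp (- real d * w)" by (simp flip: exp_add)
    finally show ?thesis by simp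
  qed
  have "l * exp (d * (1 / 2 - 2 * w)) \<le> exp (- real d * w) / 2"
    by (rule bound) (use dw in \<open>simp add: algebra_simps\<close>)
  moreover have "l * exp (d * (- 9 / 4 * w)) \<le> exp (- real d * w) / 2"
    by (rule bound) (use dw in \<open>simp add: algebra_simps\<close>)
  ultimately show ?thesis
    by (simp add: w_def distrib_left power_divide power_mult_distrib algebra_simps)
qed

lemma min_dist:
  obtains \<delta> where "\<delta> > 0" "\<And>x y. x \<in> X \<Longrightarrow> y \<in> X \<Longrightarrow> edist m x y < \<delta> \<Longrightarrow> x = y"
proof -
  \<comment> \<open>The element 1 keeps \<open>D\<close> nonempty when \<open>X\<close> has no two
    distinct points.\<close>
  define D where "D = insert 1 ((\<lambda>(x, y). edist m x y) ` (X \<times> X) - {0})"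
  have D: "finite D" "D \<noteq> {}" using finite_X by (auto simp: D_def)
  show ?thesis
  proof
    have "z > 0" if "z \<in> D" for z using that by (auto simp: D_def order_less_le)
    then show "Min D > 0" using D by simp
  next
    fix x y assume xy: "x \<in> X" "y \<in> X" "edist m x y < Min D"
    then have "edist m x y \<notin> D" using D Min_le[of D "edist m x y"] by auto
    then have "edist m x y = 0" using xy by (auto simp: D_def)
    then show "x = y" using edist_eq_0_iff X_sub xy by blast
  qed
qed

text \<open>Rescaling the ball by \<open>1/2\<close> while giving up \<open>u / 4\<close> on the net point turns the deviation
  parameter \<open>u\<close> into \<open>3 u / 2\<close>, and the Gaussian tail at the larger parameter absorbs the union
  bound over the net.\<close>

lemma prob_ball_expanded:
  fixes u R :: real
  assumes "z \<in> X" "R > 0" "u \<ge> 17"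
  shows "prob {G \<in> space M. \<exists>q\<in>rel_ball m X z R. u * R < pdist G q z} \<le> exp (- real d * u\<^sup>2 / 288)"
proof -
  obtain \<delta> where \<delta>: "\<delta> > 0" "\<And>x y. x \<in> X \<Longrightarrow> y \<in> X \<Longrightarrow> edist m x y < \<delta> \<Longrightarrow> x = y"
    using min_dist by blast
  \<comment> \<open>Induction on the number of halvings that bring \<open>R\<close> below the
    minimal distance of \<open>X\<close>; at that scale the ball is \<open>{z}\<close> and the event
    is empty.\<close>
  have "prob {G \<in> space M. \<exists>q\<in>rel_ball m X z R. u * R < pdist G q z} \<le> exp (- real d * u\<^sup>2 / 288)"
    if "R < 2 ^ n * \<delta>" for n
    using that assms
  proof (induction n arbitrary: R u z)
    case 0
    then have "rel_ball m X z R = {z}" using \<delta>(2)[of z] by (fastforce simp: rel_ball_def)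
    then have none: "{G \<in> space M. \<exists>q\<in>rel_ball m X z R. u * R < pdist G q z} = {}"
      using 0 by (simp add: not_less)
    show ?case unfolding none by simp
  next
    case (Suc n)
    obtain S where S: "S \<subseteq> X" "finite S" "card S \<le> l"
      "rel_ball m X z R \<subseteq> (\<Union>s\<in>S. rel_ball m X s (R / 2))"
      using cover[OF Suc.prems(2,3)] by blast
    \<comment> \<open>Only centres within \<open>R + R / 2\<close> of \<open>z\<close> can serve a
      point of the ball, and for these the one-point tail applies at scale
      \<open>3 / 2 * R\<close>.\<close>
    define N where "N = {s \<in> S. edist m s z \<le> 3 / 2 * R}"
    have N: "finite N" "card N \<le> l" "N \<subseteq> X"
      using S card_mono[of S N] by (auto simp: N_def)
    \<comment> \<open>The budget \<open>u * R\<close> is split into \<open>u * R / 4\<close> for the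
      centre, hence the deviation \<open>u / 6\<close> at its scale, and
      \<open>3 * u * R / 4\<close> for the ball of radius \<open>R / 2\<close>.\<close>
    define A where "A s = {G \<in> space M. u / 6 * (3 / 2 * R) < pdist G s z}" for s
    define B where "B s = {G \<in> space M. \<exists>q\<in>rel_ball m X s (R / 2). 3 * u / 2 * (R / 2) < pdist G q s}" for s
    have ev [measurable]: "A s \<in> events" "B s \<in> events" for s unfolding A_def B_def by measurable
    have "{G \<in> space M. \<exists>q\<in>rel_ball m X z R. u * R < pdist G q z} \<subseteq> (\<Union>s\<in>N. A s \<union> B s)"
    proof safe
      fix G q assume G: "G \<in> space M" and q: "q \<in> rel_ball m X z R" "u * R < pdist G q z"
      obtain s where s: "s \<in> S" "q \<in> rel_ball m X s (R / 2)" using S(4) q by blast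
      have "edist m s z \<le> 3 / 2 * R"
        using edist_triangle[of m s z q] q s by (simp add: rel_ball_def edist_commute)
      then have "s \<in> N" using s by (simp add: N_def)
      moreover have "G \<in> A s \<union> B s"
      proof (rule ccontr)
        assume "G \<notin> A s \<union> B s"
        then have "pdist G s z \<le> u * R / 4" "pdist G q s \<le> 3 * u * R / 4"
          using G s by (auto simp: A_def B_def not_less mult.commute)
        then show False using q(2) pdist_triangle[of G q z s] by simp
      qed
      ultimately show "G \<in> (\<Union>s\<in>N. A s \<union> B s)" by blast
    qed
    then have "prob {G \<in> space M. \<exists>q\<in>rel_ball m X z R. u * R < pdist G q z}
       \<le> prob (\<Union>s\<in>N. A s \<union> B s)"
      using N by (intro finite_measure_mono) auto
    also have "\<dots> \<le> l * (exp (d / 2 - real d * (u / 6)\<^sup>2 / 4) + exp (- real d * (3 * u / 2)\<^sup>2 / 288))"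
    proof (rule union_bound[OF N(1,2)])
      fix s assume s: "s \<in> N"
      have "prob (A s) \<le> exp (d / 2 - real d * (u / 6)\<^sup>2 / 4)"
        unfolding A_def by (rule prob_pdist_gt) (use s Suc.prems in \<open>auto simp: N_def\<close>)
      moreover have "prob (B s) \<le> exp (- real d * (3 * u / 2)\<^sup>2 / 288)"
        unfolding B_def by (rule Suc.IH) (use s N Suc.prems in auto)
      moreover have "prob (A s \<union> B s) \<le> prob (A s) + prob (B s)"
        by (intro measure_Un_le) auto
      ultimately show "prob (A s \<union> B s) \<le> exp (d / 2 - real d * (u / 6)\<^sup>2 / 4) + exp (- real d * (3 * u / 2)\<^sup>2 / 288)"
        by linarith
    qed auto
    also have "\<dots> \<le> exp (- real d * u\<^sup>2 / 288)" by (rule chaining_step[OF Suc.prems(4)])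
    finally show ?case .
  qed
  moreover obtain n where "R / \<delta> < 2 ^ n" using real_arch_pow[of 2 "R / \<delta>"] by auto
  ultimately show ?thesis using \<delta>(1) by (simp add: divide_less_eq)
qed

text \<open>Halving the radius \<open>k\<close> times covers the large ball by at most
  \<open>l ^ k\<close> balls of radius \<open>r\<close>, so a bound that is uniform over the small
  balls loses a factor \<open>l ^ k\<close>.\<close>

lemma prob_ball_cover:
  fixes r b :: real
  assumes "r > 0" "\<And>q. q \<in> X \<Longrightarrow> {G \<in> space M. P q G} \<in> events"
    and b: "\<And>s. s \<in> X \<Longrightarrow> prob {G \<in> space M. \<exists>q\<in>rel_ball m X s r. P q G} \<le> b"
    and "x \<in> X"
  shows "prob {G \<in> space M. \<exists>q\<in>rel_ball m X x (2 ^ k * r). P q G} \<le> l ^ k * b"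
  using \<open>x \<in> X\<close>
proof (induction k arbitrary: x)
  case 0
  then show ?case using b by simp
next
  case (Suc k)
  have "b \<ge> 0" using b[OF Suc.prems] measure_nonneg order_trans by blast
  obtain S where S: "S \<subseteq> X" "finite S" "card S \<le> l"
      "rel_ball m X x (2 ^ Suc k * r) \<subseteq> (\<Union>s\<in>S. rel_ball m X s (2 ^ Suc k * r / 2))"
    using cover[OF Suc.prems, of "2 ^ Suc k * r"] assms(1) by auto
  have "{G \<in> space M. \<exists>q\<in>rel_ball m X x (2 ^ Suc k * r). P q G}
     \<subseteq> (\<Union>s\<in>S. {G \<in> space M. \<exists>q\<in>rel_ball m X s (2 ^ k * r). P q G})"
  proof safe
    fix G q assume "G \<in> space M" "q \<in> rel_ball m X x (2 ^ Suc k * r)" "P q G"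
    moreover from this obtain s where "s \<in> S" "q \<in> rel_ball m X s (2 ^ k * r)"
      using S(4) by auto
    ultimately show "G \<in> (\<Union>s\<in>S. {G \<in> space M. \<exists>q\<in>rel_ball m X s (2 ^ k * r). P q G})"
      by blast
  qed
  then have "prob {G \<in> space M. \<exists>q\<in>rel_ball m X x (2 ^ Suc k * r). P q G}
     \<le> prob (\<Union>s\<in>S. {G \<in> space M. \<exists>q\<in>rel_ball m X s (2 ^ k * r). P q G})"
    using S assms(2) by (intro finite_measure_mono sets.finite_UN event_rel_ball) auto
  also have "\<dots> \<le> l * (l ^ k * b)"
    by (rule union_bound) (use S Suc.IH assms(2) \<open>b \<ge> 0\<close> in \<open>auto intro!: event_rel_ball\<close>)
  finally show ?case by simp
qed

section \<open>Bad events\<close>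

text \<open>The outer radius is \<open>2 ^ (2 * j + 2) * r\<close>, so \<open>2 * j + 2\<close>
  halvings lead to balls of radius \<open>r\<close>. If such a ball contains a contracted point,
  then its centre is contracted as well or the ball is stretched beyond
  \<open>2 ^ j * r\<close>.\<close>

lemma prob_annulus_contracted:
  fixes r :: real
  assumes "p \<in> X" "r > 0" "j \<ge> 10"
  shows "prob {G \<in> space M. \<exists>q\<in>rel_ball m X p (4 ^ (j + 1) * r).
      4 ^ j * r \<le> edist m p q \<and> pdist G q p \<le> 6 * 2 ^ j * r}
    \<le> l ^ (2 * j + 2) * (exp (- real d * 4 ^ j / 288) + (28 / 2 ^ j) ^ d)"
proof -
  have "prob {G \<in> space M. \<exists>q\<in>rel_ball m X s r. 4 ^ j * r \<le> edist m p q \<and> pdist G q p \<le> 6 * 2 ^ j * r}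
    \<le> exp (- real d * 4 ^ j / 288) + (28 / 2 ^ j) ^ d" (is "prob ?E \<le> _") if s: "s \<in> X" for s
  proof (cases "edist m s p \<ge> 4 ^ j * r / 2")
    case True
    define A where "A = {G \<in> space M. \<exists>q\<in>rel_ball m X s r. 2 ^ j * r < pdist G q s}"
    \<comment> \<open>The centre lands within \<open>(6 + 1) * 2 ^ j * r\<close> of the image of
      \<open>p\<close>; relative to its distance of at least \<open>4 ^ j * r / 2\<close> this is
      the fraction \<open>14 / 2 ^ j\<close>.\<close>
    define B where "B = {G \<in> space M. pdist G s p \<le> 14 / 2 ^ j * (4 ^ j * r / 2)}"
    have ev [measurable]: "A \<in> events" "B \<in> events" unfolding A_def B_def by measurable
    have eq: "14 / 2 ^ j * (4 ^ j * r / 2) = 7 * 2 ^ j * r"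
      by (simp add: field_simps flip: power_mult_distrib)
    have "?E \<subseteq> A \<union> B"
    proof safe
      fix G q assume *: "G \<in> space M" "q \<in> rel_ball m X s r" "pdist G q p \<le> 6 * 2 ^ j * r" "G \<notin> B"
      then have "7 * 2 ^ j * r < pdist G s p" unfolding B_def eq by auto
      then have "2 ^ j * r < pdist G q s"
        using *(3) pdist_triangle[of G s p q] pdist_commute[of G s q] by linarith
      then show "G \<in> A" using * by (auto simp: A_def)
    qed
    then have "prob ?E \<le> prob (A \<union> B)" by (intro finite_measure_mono) auto
    also have "\<dots> \<le> prob A + prob B" by (intro measure_Un_le) auto
    also have "prob A \<le> exp (- real d * ((2::real) ^ j)\<^sup>2 / 288)" unfolding A_def
    proof (rule prob_ball_expanded)
      have "(17::real) \<le> 2 ^ 10" by simp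
      also have "\<dots> \<le> 2 ^ j" using assms by (intro power_increasing) auto
      finally show "(17::real) \<le> 2 ^ j" .
    qed (use s assms in auto)
    also have "((2::real) ^ j)\<^sup>2 = 4 ^ j" by (simp add: power2_eq_square flip: power_mult_distrib)
    also have "prob B \<le> (2 * (14 / 2 ^ j)) ^ d" unfolding B_def
      by (rule prob_pdist_le) (use True assms in auto)
    finally show ?thesis by simp
  next
    case False
    \<comment> \<open>A ball whose centre is this close to \<open>p\<close> does not reach the
      annulus.\<close>
    have "(2::real) \<le> 4 ^ 1" by simp
    also have "\<dots> \<le> 4 ^ j" using assms by (intro power_increasing) auto
    finally have "2 * r \<le> 4 ^ j * r" using assms by simp
    then have "edist m p q < 4 ^ j * r" if "q \<in> rel_ball m X s r" for q
      using False that edist_triangle[of m p q s] by (simp add: rel_ball_def edist_commute)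
    then have none: "?E = {}" by force
    show ?thesis unfolding none by simp
  qed
  from prob_ball_cover[OF \<open>r > 0\<close> _ this \<open>p \<in> X\<close>, of "2 * j + 2"]
  have "prob {G \<in> space M. \<exists>q\<in>rel_ball m X p (2 ^ (2 * j + 2) * r).
      4 ^ j * r \<le> edist m p q \<and> pdist G q p \<le> 6 * 2 ^ j * r}
    \<le> l ^ (2 * j + 2) * (exp (- real d * 4 ^ j / 288) + (28 / 2 ^ j) ^ d)"
    by measurable
  also have "(2::real) ^ (2 * j + 2) = 4 ^ (j + 1)" by (simp add: power_mult)
  finally show ?thesis .
qed

text \<open>What has to go wrong before a facility at distance between \<open>4 ^ j * r\<close> and
  \<open>4 ^ (j + 1) * r\<close> can serve \<open>p\<close>. Without the first failure the projected
  radius is at most \<open>2 * 2 ^ j * r\<close>; the 6 is this 2 times the factor 3 of local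
  optimality.\<close>

definition bad :: "(nat \<Rightarrow> real) \<Rightarrow> real \<Rightarrow> nat \<Rightarrow> (nat \<times> nat \<Rightarrow> real) set" where
  "bad p r j =
     {G \<in> space M. \<exists>q\<in>rel_ball m X p r. 2 ^ j * r < pdist G q p} \<union>
     {G \<in> space M. \<exists>q\<in>rel_ball m X p (4 ^ (j + 1) * r).
        4 ^ j * r \<le> edist m p q \<and> pdist G q p \<le> 6 * 2 ^ j * r}"

lemma event_bad [measurable]: "bad p r j \<in> events"
  unfolding bad_def by measurable

text \<open>The weight is the square of the outer radius \<open>4 ^ (j + 1)\<close>. Both tails are
  at most \<open>e\<close>, the covering costs at most \<open>exp (j * d / 50)\<close>, and what
  remains is \<open>exp (- 23 / 100 * j * d)\<close>, at most \<open>(1 / 32) ^ j\<close> since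
  \<open>d \<ge> 100\<close>. This outweighs \<open>16 ^ j\<close>.\<close>

lemma prob_bad:
  assumes "p \<in> X" "r > 0" "j \<ge> 10"
  shows "16 ^ (j + 1) * prob (bad p r j) \<le> 48 * (1 / 2) ^ j"
proof -
  define e where "e = exp (- (real j * real d) / 4)"
  have j4: "72 * real j \<le> 4 ^ j" using assms(3)
    by (induction j rule: nat_induct_at_least) auto
  have a: "exp (- real d * 4 ^ j / 288) \<le> e"
    using mult_left_mono[OF j4, of d] by (simp add: e_def algebra_simps)
  \<comment> \<open>Here \<open>4 / 3\<close> is a rational upper bound for
    \<open>exp (1 / 4)\<close>; the aim is \<open>28 / 2 ^ j \<le> exp (- j / 4)\<close>, whose
    right side has \<open>d\<close>-th power \<open>e\<close>.\<close>
  have "28 * (4 / 3) ^ j \<le> (2::real) ^ j" using assms(3)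
  proof (induction j rule: nat_induct_at_least)
    case base
    show ?case by (simp add: power_divide)
  next
    case (Suc n)
    then show ?case using zero_le_power[of "2::real" n] unfolding power_Suc by linarith
  qed
  moreover have "exp (1 / 4) ^ j \<le> (4 / 3 :: real) ^ j"
  proof (intro power_mono)
    have "3 / 4 \<le> exp (- (1 / 4) :: real)" using exp_ge_add_one_self[of "- (1 / 4) :: real"] by simp
    then show "exp (1 / 4) \<le> (4 / 3 :: real)" by (simp add: exp_minus field_simps)
  qed auto
  ultimately have "28 * exp (1 / 4) ^ j \<le> (2::real) ^ j" by linarith
  then have "28 / 2 ^ j \<le> exp (- j / 4)"
    by (simp add: exp_minus field_simps flip: exp_of_nat_mult)
  then have "(28 / 2 ^ j) ^ d \<le> exp (- j / 4) ^ d" by (intro power_mono) auto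
  then have b: "(28 / 2 ^ j) ^ d \<le> e" by (simp add: e_def algebra_simps flip: exp_of_nat_mult)
  have "real l ^ (2 * j + 2) \<le> exp (real d / 200) ^ (2 * j + 2)" using l_le by (intro power_mono) auto
  also have "\<dots> = exp ((2 * j + 2) * d / 200)" by (subst exp_of_nat_mult[symmetric]) (simp add: algebra_simps)
  also have "\<dots> \<le> exp (j * d / 50)"
  proof -
    have "real (2 * j + 2) * real d \<le> (4 * real j) * real d" using assms(3) by (intro mult_right_mono) auto
    then show ?thesis by (simp add: algebra_simps)
  qed
  finally have c: "real l ^ (2 * j + 2) \<le> exp (j * d / 50)" .
  \<comment> \<open>The stretching of the ball around \<open>p\<close> carries no covering factor
    and is padded to share that of the other terms.\<close>
  have c1: "1 \<le> exp (real j * d / 50)" by simp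
  have "(17::real) \<le> 2 ^ 10" by simp
  also have "\<dots> \<le> 2 ^ j" using assms by (intro power_increasing) auto
  finally have j17: "(17::real) \<le> 2 ^ j" .
  have "prob (bad p r j) \<le> exp (- real d * ((2::real) ^ j)\<^sup>2 / 288)
      + real l ^ (2 * j + 2) * (exp (- real d * 4 ^ j / 288) + (28 / 2 ^ j) ^ d)"
    unfolding bad_def
    by (rule order_trans[OF measure_Un_le add_mono[OF prob_ball_expanded[OF assms(1,2) j17]
            prob_annulus_contracted[OF assms, unfolded of_nat_mult of_nat_power]]]) measurable
  also have "((2::real) ^ j)\<^sup>2 = 4 ^ j" by (simp add: power2_eq_square flip: power_mult_distrib)
  also have "exp (- real d * 4 ^ j / 288)
      + real l ^ (2 * j + 2) * (exp (- real d * 4 ^ j / 288) + (28 / 2 ^ j) ^ d)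
    \<le> exp (j * d / 50) * e + exp (j * d / 50) * (e + e)"
    using a b c mult_mono[OF c1 a] by (intro add_mono mult_mono) auto
  also have "\<dots> = 3 * exp (- 23 / 100 * (real j * real d))"
    by (simp add: e_def algebra_simps flip: exp_add)
  also have "\<dots> \<le> 3 * exp (- 23 * real j)"
    using mult_left_mono[of 100 "real d" "real j"] d_ge_100 by (simp add: mult.commute)
  also have "\<dots> = 3 * exp (- 23) ^ j" by (simp add: mult.commute flip: exp_of_nat_mult)
  also have "\<dots> \<le> 3 * (1 / 32) ^ j"
  proof (intro mult_left_mono power_mono)
    have "(32::real) \<le> 2 ^ 23" by simp
    also have "\<dots> \<le> exp 1 ^ 23" using exp_ge_add_one_self[of "1::real"] by (intro power_mono) auto
    also have "\<dots> = exp (23::real)" by (simp flip: exp_of_nat_mult)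
    finally show "exp (- 23) \<le> (1 / 32 :: real)" by (simp add: exp_minus field_simps)
  qed auto
  finally have "16 ^ (j + 1) * prob (bad p r j) \<le> 16 ^ (j + 1) * (3 * (1 / 32) ^ j)"
    by (intro mult_left_mono) auto
  also have "\<dots> = 48 * (16 * (1 / 32)) ^ j" by (simp only: power_mult_distrib) simp
  finally show ?thesis by simp
qed

end

section \<open>Radii and facilities\<close>

lemma sq_radius:
  assumes "finite Y" "p \<in> Y"
  shows sq_radius_pos: "sq_radius n Y p > 0"
    and sq_radius_sum: "(\<Sum>q\<in>Y. max 0 ((sq_radius n Y p)\<^sup>2 - (edist n p q)\<^sup>2)) = 1"
  using theI'[OF sq_radius_ex1[OF assms, of n]] sq_radius_sum_eq[OF assms(1), of "sq_radius n Y p"]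
  by (simp_all add: sq_radius_def)

text \<open>The truncated sum is strictly increasing in the radius because of the summand
  \<open>q = p\<close>, so any radius at which it has reached 1 is an upper bound.\<close>

lemma sq_radius_le:
  assumes "finite Y" "p \<in> Y" "s \<ge> 0" and "1 \<le> (\<Sum>q\<in>Y. max 0 (s\<^sup>2 - (edist n p q)\<^sup>2))"
  shows "sq_radius n Y p \<le> s"
proof (rule ccontr)
  assume "\<not> sq_radius n Y p \<le> s"
  then have sq: "s\<^sup>2 < (sq_radius n Y p)\<^sup>2" using assms(3) by (simp add: power_strict_mono)
  have "(\<Sum>q\<in>Y. max 0 (s\<^sup>2 - (edist n p q)\<^sup>2))
      < (\<Sum>q\<in>Y. max 0 ((sq_radius n Y p)\<^sup>2 - (edist n p q)\<^sup>2))"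
  proof (rule sum_strict_mono_ex1[OF assms(1)])
    show "\<exists>q\<in>Y. max 0 (s\<^sup>2 - (edist n p q)\<^sup>2) < max 0 ((sq_radius n Y p)\<^sup>2 - (edist n p q)\<^sup>2)"
      using sq assms(2) by (intro bexI[of _ p]) (auto simp: less_max_iff_disj)
  qed (use sq in auto)
  then show False using sq_radius_sum[OF assms(1,2), of n] assms(4) by linarith
qed

text \<open>At radius 1 the summand \<open>q = p\<close> alone contributes 1. This later allows
  squared radii to be replaced by radii.\<close>

lemma sq_radius_le_1:
  assumes "finite Y" "p \<in> Y"
  shows "sq_radius n Y p \<le> 1"
  using member_le_sum[of p Y "\<lambda>q. max 0 (1\<^sup>2 - (edist n p q)\<^sup>2)"] assms
  by (intro sq_radius_le) auto

section \<open>Radii and injectivity under projection\<close>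

context random_proj
begin

text \<open>At the enlarged radius, a point \<open>q\<close> of the original ball contributes at
  least \<open>(u\<^sup>2 + 1) * r\<^sup>2 - u\<^sup>2 * r\<^sup>2 = r\<^sup>2\<close>, no less than
  before. Injectivity carries the sum over to the image without merging summands.\<close>

lemma sq_radius_image_le:
  assumes "finite X" "p \<in> X" "inj_on (mat_apply d m G) X" "u \<ge> 0"
    and stretch: "\<And>q. q \<in> rel_ball m X p (sq_radius m X p) \<Longrightarrow> pdist G q p \<le> u * sq_radius m X p"
  shows "sq_radius d (mat_apply d m G ` X) (mat_apply d m G p) \<le> sqrt (u\<^sup>2 + 1) * sq_radius m X p"
proof (rule sq_radius_le)
  define r where "r = sq_radius m X p"
  have r: "r > 0" unfolding r_def by (rule sq_radius_pos[OF assms(1,2)])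
  have "1 = (\<Sum>q\<in>X. max 0 (r\<^sup>2 - (edist m p q)\<^sup>2))"
    using sq_radius_sum[OF assms(1,2)] by (simp add: r_def)
  also have "\<dots> \<le> (\<Sum>q\<in>X. max 0 ((sqrt (u\<^sup>2 + 1) * r)\<^sup>2 - (pdist G p q)\<^sup>2))"
  proof (rule sum_mono)
    fix q assume q: "q \<in> X"
    show "max 0 (r\<^sup>2 - (edist m p q)\<^sup>2) \<le> max 0 ((sqrt (u\<^sup>2 + 1) * r)\<^sup>2 - (pdist G p q)\<^sup>2)"
    proof (cases "edist m p q \<le> r")
      case True
      then have "pdist G p q \<le> u * r"
        using stretch[of q] q pdist_commute[of G p q] by (simp add: rel_ball_def r_def)
      then have "(pdist G p q)\<^sup>2 \<le> u\<^sup>2 * r\<^sup>2"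
        using power_mono[of "pdist G p q" "u * r" 2] by (simp add: power_mult_distrib)
      moreover have "(sqrt (u\<^sup>2 + 1) * r)\<^sup>2 = u\<^sup>2 * r\<^sup>2 + r\<^sup>2"
        by (simp add: power_mult_distrib distrib_right)
      ultimately have "r\<^sup>2 - (edist m p q)\<^sup>2 \<le> (sqrt (u\<^sup>2 + 1) * r)\<^sup>2 - (pdist G p q)\<^sup>2"
        using zero_le_power2[of "edist m p q"] by linarith
      then show ?thesis by auto
    next
      case False
      then have "r\<^sup>2 \<le> (edist m p q)\<^sup>2" using r by (intro power_mono) auto
      then show ?thesis by auto
    qed
  qed
  also have "\<dots> = (\<Sum>y\<in>mat_apply d m G ` X.
      max 0 ((sqrt (u\<^sup>2 + 1) * r)\<^sup>2 - (edist d (mat_apply d m G p) y)\<^sup>2))"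
    by (simp add: sum.reindex[OF assms(3)] pdist_def)
  finally show "1 \<le> (\<Sum>y\<in>mat_apply d m G ` X.
      max 0 ((sqrt (u\<^sup>2 + 1) * sq_radius m X p)\<^sup>2 - (edist d (mat_apply d m G p) y)\<^sup>2))"
    by (simp add: r_def)
qed (use assms sq_radius_pos[OF assms(1,2), of m] in auto)

text \<open>A fixed pair of distinct points collapses with probability at most
  \<open>(2 * \<delta>) ^ d\<close> for every positive \<open>\<delta>\<close>, hence with
  probability 0, and there are finitely many pairs.\<close>

lemma AE_inj_on:
  assumes "finite X" "X \<subseteq> topspace (Euclidean_space m)"
  shows "AE G in M. inj_on (mat_apply d m G) X"
proof -
  have "AE G in M. x \<noteq> y \<longrightarrow> mat_apply d m G x \<noteq> mat_apply d m G y" if "x \<in> X" "y \<in> X" for x y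
  proof (cases "x = y")
    case False
    define \<rho> where "\<rho> = edist m x y"
    have \<rho>: "\<rho> > 0"
      using False that assms edist_eq_0_iff[of x m y] by (auto simp: \<rho>_def order_less_le)
    define Z where "Z = {G \<in> space M. pdist G x y \<le> 0}"
    have Z [measurable]: "Z \<in> events" unfolding Z_def by measurable
    have "prob Z \<le> e" if "e > 0" for e
    proof -
      \<comment> \<open>The cap \<open>1 / 2\<close> makes \<open>2 * \<delta> \<le> 1\<close>, so
        that the \<open>d\<close>-th power is at most the first.\<close>
      define \<delta> where "\<delta> = min (1 / 2) (e / 2)"
      have \<delta>: "0 < \<delta>" "2 * \<delta> \<le> 1" "2 * \<delta> \<le> e" using that by (auto simp: \<delta>_def)
      have "0 < \<delta> * \<rho>" using \<delta> \<rho> by simp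
      then have "Z \<subseteq> {G \<in> space M. pdist G x y \<le> \<delta> * \<rho>}" unfolding Z_def by force
      then have "prob Z \<le> prob {G \<in> space M. pdist G x y \<le> \<delta> * \<rho>}"
        by (intro finite_measure_mono) auto
      also have "\<dots> \<le> (2 * \<delta>) ^ d" by (rule prob_pdist_le) (use \<delta> \<rho> \<rho>_def in auto)
      also have "\<dots> \<le> (2 * \<delta>) ^ 1" by (rule power_decreasing) (use \<delta> d_ge_1 in auto)
      finally show ?thesis using \<delta> by simp
    qed
    then have "prob Z = 0" using field_le_epsilon[of "prob Z" 0] by (simp add: antisym)
    then have "AE G in M. G \<notin> Z" using prob_eq_0[OF Z] by simp
    with AE_space show ?thesis by eventually_elim (auto simp: Z_def pdist_def)
  qed simp
  then have "AE G in M. \<forall>x\<in>X. \<forall>y\<in>X. x \<noteq> y \<longrightarrow> mat_apply d m G x \<noteq> mat_apply d m G y"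
    by (intro AE_finite_allI[OF assms(1)]) auto
  then show ?thesis by eventually_elim (auto simp: inj_on_def)
qed

end

section \<open>Expected squared distance from a point to the facilities\<close>

context doubling_proj
begin

text \<open>The facility that serves \<open>p\<close> in the projection either lies within
  \<open>4 ^ 10 * r\<close>, or lies in an annulus of some index \<open>j \<ge> 10\<close>. In the
  latter case \<open>bad p r j\<close> occurs, and its summand pays for the squared distance. The
  bound \<open>N\<close> keeps the sum finite.\<close>

lemma min_dist_bound:
  assumes "p \<in> X" "inj_on (mat_apply d m G) X" "G \<in> space M"
    and F: "F \<subseteq> X" "locally_optimal d (mat_apply d m G ` X) (mat_apply d m G ` F)"
    and N: "\<And>q. q \<in> X \<Longrightarrow> edist m p q < 4 ^ N * sq_radius m X p"
  shows "Min ((\<lambda>f. (edist m p f)\<^sup>2) ` F)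
    \<le> (16 ^ 10 + (\<Sum>j=10..<N. 16 ^ (j + 1) * indicator (bad p (sq_radius m X p) j) G))
       * (sq_radius m X p)\<^sup>2"
proof -
  define r where "r = sq_radius m X p"
  let ?S = "\<Sum>j=10..<N. 16 ^ (j + 1) * indicator (bad p r j) G :: real"
  have r: "r > 0" unfolding r_def by (rule sq_radius_pos[OF finite_X assms(1)])
  have S0: "?S \<ge> 0" by (intro sum_nonneg) auto
  obtain f where f: "f \<in> F"
    "pdist G p f \<le> 3 * sq_radius d (mat_apply d m G ` X) (mat_apply d m G p)"
    using F(2) assms(1) unfolding locally_optimal_def pdist_def by blast
  have fX: "f \<in> X" using f F by blast
  have "finite F" using F finite_X finite_subset by blast
  then have "Min ((\<lambda>f. (edist m p f)\<^sup>2) ` F) \<le> (edist m p f)\<^sup>2" using f by (intro Min_le) auto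
  also have "\<dots> \<le> (16 ^ 10 + ?S) * r\<^sup>2"
  proof (cases "edist m p f < 4 ^ 10 * r")
    case True
    then have "(edist m p f)\<^sup>2 \<le> (4 ^ 10 * r)\<^sup>2" by (intro power_mono) auto
    also have "\<dots> = 16 ^ 10 * r\<^sup>2" by (simp add: power_mult_distrib)
    also have "\<dots> \<le> (16 ^ 10 + ?S) * r\<^sup>2" using S0 by (intro mult_right_mono) auto
    finally show ?thesis .
  next
    case False
    \<comment> \<open>Minimality gives both sides of the annulus: the predecessor \<open>j\<close>
      of \<open>n\<close> satisfies
      \<open>4 ^ j * r \<le> edist m p f < 4 ^ (j + 1) * r\<close>.\<close>
    define n where "n = (LEAST n. edist m p f < 4 ^ n * r)"
    have n: "edist m p f < 4 ^ n * r" "n \<le> N"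
      unfolding n_def using N[OF fX] unfolding r_def by (rule LeastI, rule Least_le)
    have "n > 10"
    proof (rule ccontr)
      assume "\<not> n > 10"
      then have "4 ^ n * r \<le> 4 ^ 10 * r" using r by (intro mult_right_mono power_increasing) auto
      then show False using n False by linarith
    qed
    then obtain j where j: "n = Suc j" "j \<ge> 10" by (cases n) auto
    then have lower: "4 ^ j * r \<le> edist m p f"
      using not_less_Least[of j "\<lambda>n. edist m p f < 4 ^ n * r"] by (simp add: n_def not_less)
    have "G \<in> bad p r j"
    proof (rule ccontr)
      assume nb: "G \<notin> bad p r j"
      have "sq_radius d (mat_apply d m G ` X) (mat_apply d m G p) \<le> sqrt ((2 ^ j)\<^sup>2 + 1) * r"
        unfolding r_def by (rule sq_radius_image_le[OF finite_X assms(1,2)])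
          (use nb assms(3) in \<open>auto simp: bad_def r_def not_less\<close>)
      also have "sqrt ((2 ^ j)\<^sup>2 + 1) \<le> 2 * 2 ^ j"
      proof (rule real_le_lsqrt)
        have "(1::real) \<le> (2 ^ j)\<^sup>2" by simp
        moreover have "(2 * 2 ^ j :: real)\<^sup>2 = 4 * (2 ^ j)\<^sup>2" by (simp add: power_mult_distrib)
        ultimately show "(2 ^ j)\<^sup>2 + 1 \<le> (2 * 2 ^ j :: real)\<^sup>2" by linarith
      qed auto
      finally have "pdist G f p \<le> 6 * 2 ^ j * r"
        using f(2) r by (simp add: pdist_commute)
      then have "G \<in> bad p r j"
        using lower n(1) j fX assms(3) by (auto simp: bad_def rel_ball_def intro!: bexI[of _ f])
      then show False using nb by contradiction
    qed
    then have "16 ^ (j + 1) \<le> ?S"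
      using member_le_sum[of j "{10..<N}" "\<lambda>j. 16 ^ (j + 1) * indicator (bad p r j) G :: real"] j n(2)
      by simp
    have "(edist m p f)\<^sup>2 \<le> (4 ^ (j + 1) * r)\<^sup>2" using n(1) j by (intro power_mono) auto
    also have "\<dots> = 16 ^ (j + 1) * r\<^sup>2"
      by (simp add: power_mult_distrib power2_eq_square flip: power_mult_distrib[of 4 4])
    also have "\<dots> \<le> (16 ^ 10 + ?S) * r\<^sup>2"
      using \<open>16 ^ (j + 1) \<le> ?S\<close> by (intro mult_right_mono) auto
    finally show ?thesis .
  qed
  finally show ?thesis by (simp add: r_def)
qed

text \<open>In expectation the weighted bad events are dominated by a geometric series of total at
  most 96, whatever \<open>N\<close> is; \<open>16 ^ 11\<close> generously covers
  \<open>16 ^ 10 + 96\<close>.\<close>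

lemma integral_min_dist_le:
  assumes p: "p \<in> X" and F: "F \<in> measurable M (count_space (Pow X))"
    and opt: "AE G in M. locally_optimal d (mat_apply d m G ` X) (mat_apply d m G ` F G)"
  shows "(\<integral>G. Min ((\<lambda>f. (edist m p f)\<^sup>2) ` F G) \<partial>M) \<le> 16 ^ 11 * (sq_radius m X p)\<^sup>2"
proof -
  define r where "r = sq_radius m X p"
  have r: "r > 0" unfolding r_def by (rule sq_radius_pos[OF finite_X p])
  define K where "K = Max (edist m p ` X)"
  obtain N where "K / r < 4 ^ N" using real_arch_pow[of 4 "K / r"] by auto
  then have "K < 4 ^ N * r" using r by (simp add: divide_less_eq)
  then have N: "edist m p q < 4 ^ N * r" if "q \<in> X" for q
    using Max_ge[of "edist m p ` X" "edist m p q"] that finite_X order_le_less_trans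
    unfolding K_def by blast
  define S where "S G = (\<Sum>j=10..<N. 16 ^ (j + 1) * indicator (bad p r j) G :: real)" for G
  let ?g = "\<lambda>G. (16 ^ 10 + S G) * r\<^sup>2"
  have int [simp]: "integrable M (\<lambda>G. indicator (bad p r j) G :: real)" for j
    by (intro integrable_real_indicator) (auto simp: less_top[symmetric])
  have S: "integrable M S" "(\<integral>G. S G \<partial>M) = (\<Sum>j=10..<N. 16 ^ (j + 1) * prob (bad p r j))"
    unfolding S_def
    by (intro Bochner_Integration.integrable_sum integrable_mult_right int)
       (subst Bochner_Integration.integral_sum, auto simp: sets.Int_space_eq2)
  have "(\<integral>G. Min ((\<lambda>f. (edist m p f)\<^sup>2) ` F G) \<partial>M) \<le> (\<integral>G. ?g G \<partial>M)"
  \<comment> \<open>A nonintegrable function has Bochner integral 0, so an integrable nonnegative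
    majorant is enough.\<close>
  proof (rule integral_mono_AE')
    show "integrable M ?g" using S by simp
    show "AE G in M. Min ((\<lambda>f. (edist m p f)\<^sup>2) ` F G) \<le> ?g G"
      using opt AE_inj_on[OF finite_X X_sub] AE_space
    proof eventually_elim
      case (elim G)
      then have "F G \<subseteq> X" using measurable_space[OF F] by auto
      then show ?case using min_dist_bound[OF p elim(2,3) _ elim(1)] N by (simp add: S_def r_def)
    qed
    show "AE G in M. 0 \<le> ?g G" unfolding S_def by (intro AE_I2 mult_nonneg_nonneg add_nonneg_nonneg sum_nonneg) auto
  qed
  also have "\<dots> = (16 ^ 10 + (\<Sum>j=10..<N. 16 ^ (j + 1) * prob (bad p r j))) * r\<^sup>2"
    using S by (simp add: prob_space)
  also have "\<dots> \<le> (16 ^ 10 + (\<Sum>j=10..<N. 48 * (1 / 2) ^ j)) * r\<^sup>2"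
    by (intro mult_right_mono add_left_mono sum_mono prob_bad) (use p r in auto)
  also have "\<dots> \<le> (16 ^ 10 + 48 * 2) * r\<^sup>2"
  proof (intro mult_right_mono add_left_mono)
    have "(\<Sum>j=10..<N. (1 / 2 :: real) ^ j) \<le> (\<Sum>j. (1 / 2) ^ j)"
      by (intro sum_le_suminf summable_geometric) auto
    also have "\<dots> = 2" by (subst suminf_geometric) auto
    finally show "(\<Sum>j=10..<N. 48 * (1 / 2 :: real) ^ j) \<le> 48 * 2"
      by (simp flip: sum_distrib_left)
  qed auto
  also have "\<dots> \<le> 16 ^ 11 * r\<^sup>2" by (intro mult_right_mono) auto
  finally show ?thesis by (simp add: r_def)
qed

end

section \<open>Summation over the dataset\<close>

theorem corollaryF8:
  shows "\<exists>C\<^sub>0 > (0::real). \<exists>C' > (0::real).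
    \<forall>(m::nat) (d::nat) (X :: (nat \<Rightarrow> real) set) (\<epsilon>::real)
      (F :: (nat \<times> nat \<Rightarrow> real) \<Rightarrow> (nat \<Rightarrow> real) set).
      finite X \<longrightarrow> X \<noteq> {} \<longrightarrow> X \<subseteq> topspace (Euclidean_space m) \<longrightarrow>
      0 < \<epsilon> \<longrightarrow> \<epsilon> < 1 / 2 \<longrightarrow>
      d \<ge> 1 \<longrightarrow>
      real d \<ge> C\<^sub>0 * ln (real (doubling_constant m X)) * ln (1 / \<epsilon>) / \<epsilon>\<^sup>2 \<longrightarrow>
      F \<in> measurable (random_projection d m) (count_space (Pow X)) \<longrightarrow>
      (AE G in random_projection d m.
         locally_optimal d (mat_apply d m G ` X) (mat_apply d m G ` F G)) \<longrightarrow>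
      (\<integral>G. fl_cost m X (F G) \<partial>random_projection d m)
        \<le> (\<integral>G. real (card (F G)) \<partial>random_projection d m)
          + C' * (\<Sum>p\<in>X. sq_radius m X p)"
proof (rule exI[of _ 100], rule conjI[OF _ exI[of _ "16 ^ 11"]], goal_cases)
  case 2
  have main: "(\<integral>G. fl_cost m X (F G) \<partial>random_projection d m)
        \<le> (\<integral>G. real (card (F G)) \<partial>random_projection d m)
          + 16 ^ 11 * (\<Sum>p\<in>X. sq_radius m X p)"
    if X: "finite X" "X \<noteq> {}" "X \<subseteq> topspace (Euclidean_space m)"
      and \<epsilon>: "0 < \<epsilon>" "\<epsilon> < 1 / 2"
      and d: "d \<ge> 1"
      and d_ge: "real d \<ge> 100 * ln (real (doubling_constant m X)) * ln (1 / \<epsilon>) / \<epsilon>\<^sup>2"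
      and F: "F \<in> measurable (random_projection d m) (count_space (Pow X))"
      and opt: "AE G in random_projection d m.
         locally_optimal d (mat_apply d m G ` X) (mat_apply d m G ` F G)"
    for m d :: nat and X :: "(nat \<Rightarrow> real) set" and \<epsilon> :: real
      and F :: "(nat \<times> nat \<Rightarrow> real) \<Rightarrow> (nat \<Rightarrow> real) set"
  proof -
    interpret random_proj d m by unfold_locales (rule d)
    \<comment> \<open>\<open>F\<close> takes values in the finite set \<open>Pow X\<close>, so every
      real function of it is bounded, and it is measurable since the target is discrete.\<close>
    have integrable: "integrable M (\<lambda>G. h (F G))" for h :: "_ \<Rightarrow> real"
    proof (rule integrable_const_bound)
      show "AE G in M. norm (h (F G)) \<le> (\<Sum>A\<in>Pow X. norm (h A))"
        using measurable_space[OF F] X(1)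
        by (intro AE_I2 member_le_sum[of _ _ "\<lambda>A. norm (h A)"]) auto
      show "(\<lambda>G. h (F G)) \<in> borel_measurable M"
        by (rule measurable_compose[OF F]) simp
    qed
    have point: "(\<integral>G. Min ((\<lambda>f. (edist m p f)\<^sup>2) ` F G) \<partial>M) \<le> 16 ^ 11 * (sq_radius m X p)\<^sup>2"
      if p: "p \<in> X" for p
    proof (cases "X = {p}")
      case True
      have "AE G in M. Min ((\<lambda>f. (edist m p f)\<^sup>2) ` F G) \<le> 0"
        using opt AE_space
      proof eventually_elim
        case (elim G)
        then have "F G \<subseteq> {p}" "F G \<noteq> {}"
          using measurable_space[OF F] True by (auto simp: locally_optimal_def)
        then have "F G = {p}" by blast
        then show ?case by simp
      qed
      then have "(\<integral>G. Min ((\<lambda>f. (edist m p f)\<^sup>2) ` F G) \<partial>M) \<le> (\<integral>G. 0 \<partial>M)"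
        by (intro integral_mono_AE integrable) auto
      then show ?thesis by (simp add: order_trans)
    next
      case False
      then obtain q where q: "q \<in> X" "p \<noteq> q" using p by blast
      define l where "l = doubling_constant m X"
      have l: "l \<ge> 2" unfolding l_def by (rule doubling_constant_ge_2[OF X(1,3) p q])
      have half: "1 / 2 \<le> ln (2::real)" using ln_2_less_1 ln_le_minus_one[of "1/2::real"]
        by (simp add: ln_div)
      have "ln 2 \<le> ln (1 / \<epsilon>)" using \<epsilon> by (subst ln_le_cancel_iff) (auto simp: field_simps)
      then have a: "1 / 2 \<le> ln (1 / \<epsilon>)" using half by linarith
      have "\<epsilon>\<^sup>2 \<le> (1 / 2)\<^sup>2" using \<epsilon> by (intro power_mono) auto
      then have b: "4 \<le> 1 / \<epsilon>\<^sup>2" using \<epsilon> by (simp add: field_simps power2_eq_square)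
      have ln_l: "1 / 2 \<le> ln l" using half l ln_le_cancel_iff[of 2 "real l"] by linarith
      \<comment> \<open>On \<open>\<epsilon> < 1 / 2\<close> the factor
        \<open>ln (1 / \<epsilon>) / \<epsilon>\<^sup>2\<close> is at least 2, so the constant 100
        yields \<open>200 * ln l \<le> d\<close>, which is \<open>l_le\<close>.\<close>
      have "2 = 1 / 2 * (4::real)" by simp
      also have "\<dots> \<le> ln (1 / \<epsilon>) * (1 / \<epsilon>\<^sup>2)" using a b by (intro mult_mono) auto
      finally have "100 * ln l * 2 \<le> 100 * ln l * (ln (1 / \<epsilon>) * (1 / \<epsilon>\<^sup>2))"
        using ln_l by (intro mult_left_mono) auto
      also have "\<dots> \<le> d" using d_ge by (simp add: l_def mult.assoc)
      finally have d200: "200 * ln l \<le> d" by simp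
      interpret doubling_proj d m X l
      proof
        show "\<exists>S\<subseteq>X. finite S \<and> card S \<le> l \<and> rel_ball m X x r \<subseteq> (\<Union>s\<in>S. rel_ball m X s (r / 2))"
          if "x \<in> X" "r > 0" for x r
          using doubling_constant_cover[OF X(1) that, of m] unfolding l_def by metis
        have "real l = exp (ln l)" using l by simp
        also have "\<dots> \<le> exp (d / 200)" using d200 by (subst exp_le_cancel_iff) simp
        finally show "real l \<le> exp (d / 200)" .
        show "d \<ge> 100" using d200 ln_l by linarith
      qed (use X l in auto)
      show ?thesis by (rule integral_min_dist_le[OF p F opt])
    qed
    have "(\<integral>G. fl_cost m X (F G) \<partial>M)
        = (\<integral>G. real (card (F G)) \<partial>M) + (\<Sum>p\<in>X. \<integral>G. Min ((\<lambda>f. (edist m p f)\<^sup>2) ` F G) \<partial>M)"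
      unfolding fl_cost_def
      by (subst Bochner_Integration.integral_add)
         (auto intro!: integrable[of "\<lambda>A. real (card A)"] Bochner_Integration.integrable_sum
            integrable[of "\<lambda>A. Min ((\<lambda>f. (edist m _ f)\<^sup>2) ` A)"] Bochner_Integration.integral_sum)
    also have "(\<Sum>p\<in>X. \<integral>G. Min ((\<lambda>f. (edist m p f)\<^sup>2) ` F G) \<partial>M)
        \<le> (\<Sum>p\<in>X. 16 ^ 11 * sq_radius m X p)"
    proof (rule sum_mono)
      fix p assume p: "p \<in> X"
      have "(sq_radius m X p)\<^sup>2 \<le> sq_radius m X p"
        using sq_radius_le_1[OF X(1) p] sq_radius_pos[OF X(1) p]
        by (simp add: power2_eq_square mult_left_le_one_le order_less_imp_le)
      then show "(\<integral>G. Min ((\<lambda>f. (edist m p f)\<^sup>2) ` F G) \<partial>M) \<le> 16 ^ 11 * sq_radius m X p"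
        using point[OF p] by simp
    qed
    finally show ?thesis by (simp add: sum_distrib_left)
  qed
  show ?case by (intro conjI allI impI main) auto
qed auto

end
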